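(* Let $G=K_{s,t}$ be a complete bipartite graph with $1\le s \leq t$. (a) If $s=1$ then $\delta^-(G)=\infty$, and if $s \geq 2$ then $\delta^-(G)=1$. (b) If $s=1$ and $t \geq 4$, or if $s \geq 2$ and $t \geq 3$, then $\delta^+(G)=1$. In the other cases (namely when $(s,t) = (1,1), (1,2), (1,3)$ or $(2,2)$), we have $\delta^+(G)=\infty$. (c) If $s=1$ and $t \geq 4$, or if $s \geq 2$, then $\delta(G)=1$. If $(s,t) = (1,1)$ or $(1,2)$ then $\delta(G)=\infty$, and if $(s,t)=(1,3)$ then $\delta(G)=2$.
   Context: All graphs are finite and simple. For a graph $G=(V,E)$ with $m \geq 1$ edges, degrees $d_v$, for $A\subseteq V$ let ${\rm vol}(A)=\sum_{v\in A} d_v$ and let $e(A)$ be the number of edges with both ends in $A$. For a partition $\mathcal{A}$ of $V$, the modularity score is $q_{\mathcal A}(G)=\frac{1}{m}\sum_{A\in\mathcal A} e(A)-\frac{1}{4m^2}\sum_{A\in\mathcal A}{\rm vol}(A)^2$, and the modularity is $q^*(G)=\max_{\mathcal A} q_{\mathcal A}(G)$. A graph with no edges has $q^*(G)=0$. For a graph $H$: $\delta^-(H)$ is the least number of edges one can delete from $H$ to obtain a subgraph $H'$ (on the same vertex set) with $q^*(H')>0$, and $\delta^-(H)=\infty$ if no such subgraph exists; $\delta^+(H)$ is the least number of edges one can add to $H$ (between existing vertices) to obtain a graph $H'$ with $q^*(H')>0$, and $\delta^+(H)=\infty$ if none exists; $\delta(H)$ is the least number of edits (each edit adding or removing one edge,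 vertex set fixed) needed to obtain a graph $H'$ with $q^*(H')>0$, and $\delta(H)=\infty$ if none exists. *)

theory Defs
  imports Complex_Main "HOL-Library.Disjoint_Sets" "HOL-Library.Extended_Nat" "HOL-Library.Ramsey"
begin

text \<open>
  A graph is given by a vertex set \<open>V\<close> and a set \<open>E\<close> of two-element subsets of \<open>V\<close>
  (the set \<open>nsets V 2\<close> consists of all two-element subsets of \<open>V\<close>).
\<close>

definition simple_graph :: "'a set \<Rightarrow> 'a set set \<Rightarrow> bool" where
  "simple_graph V E \<longleftrightarrow> finite V \<and> E \<subseteq> nsets V 2"

definition vertex_degree :: "'a set set \<Rightarrow> 'a \<Rightarrow> nat" where
  "vertex_degree E v = card {e \<in> E. v \<in> e}"

definition vol :: "'a set set \<Rightarrow> 'a set \<Rightarrow> nat" where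
  "vol E A = (\<Sum>v\<in>A. vertex_degree E v)"

definition edges_within :: "'a set set \<Rightarrow> 'a set \<Rightarrow> nat" where
  "edges_within E A = card {e \<in> E. e \<subseteq> A}"

definition modularity_score :: "'a set set \<Rightarrow> 'a set set \<Rightarrow> real" where
  "modularity_score E P =
     1 / real (card E) * (\<Sum>A\<in>P. real (edges_within E A))
     - 1 / (4 * real (card E) ^ 2) * (\<Sum>A\<in>P. real (vol E A) ^ 2)"

definition max_modularity :: "'a set \<Rightarrow> 'a set set \<Rightarrow> real" where
  "max_modularity V E =
     (if E = {} then 0 else Max {modularity_score E P | P. partition_on V P})"

text \<open>
  In the complete lattice \<^typ>\<open>enat\<close> the infimum of the empty set is \<open>\<infinity>\<close>, and the infimum of a
  nonempty set is its least element.
\<close>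

definition delta_minus :: "'a set \<Rightarrow> 'a set set \<Rightarrow> enat" where
  "delta_minus V E = Inf {enat (card D) | D. D \<subseteq> E \<and> max_modularity V (E - D) > 0}"

definition delta_plus :: "'a set \<Rightarrow> 'a set set \<Rightarrow> enat" where
  "delta_plus V E =
     Inf {enat (card F) | F. F \<subseteq> nsets V 2 - E \<and> max_modularity V (E \<union> F) > 0}"

definition edit_step :: "'a set \<Rightarrow> ('a set set \<times> 'a set set) set" where
  "edit_step V = {(E, E'). (\<exists>e\<in>E. E' = E - {e}) \<or> (\<exists>e\<in>nsets V 2 - E. E' = insert e E)}"

definition delta :: "'a set \<Rightarrow> 'a set set \<Rightarrow> enat" where
  "delta V E =
     Inf {enat k | k. \<exists>E'. (E, E') \<in> edit_step V ^^ k \<and> max_modularity V E' > 0}"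

text \<open>\<open>(V, E)\<close> is a copy of \<open>K\<^bsub>s,t\<^esub>\<close>, on an arbitrary vertex set.\<close>

definition complete_bipartite :: "nat \<Rightarrow> nat \<Rightarrow> 'a set \<Rightarrow> 'a set set \<Rightarrow> bool" where
  "complete_bipartite s t V E \<longleftrightarrow>
     (\<exists>X Y. finite X \<and> finite Y \<and> X \<inter> Y = {} \<and> card X = s \<and> card Y = t \<and>
        V = X \<union> Y \<and> E = {{x, y} | x y. x \<in> X \<and> y \<in> Y})"

lemma complete_bipartite_simple_graph:
  "complete_bipartite s t V E \<Longrightarrow> simple_graph V E"
  by (fastforce simp: complete_bipartite_def simple_graph_def nsets_def card_2_iff)

lemma edit_step_simple_graph:
  "(E, E') \<in> edit_step V \<Longrightarrow> simple_graph V E \<Longrightarrow> simple_graph V E'"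
  by (auto simp: edit_step_def simple_graph_def)

end

theory Submission
  imports Defs
begin

text \<open>
  The score of a partition is \<open>(\<Sum>A. 4 m e(A) - vol(A)\<^sup>2) / (4 m\<^sup>2)\<close>, and if \<open>c(A)\<close> edges leave \<open>A\<close>
  then the summand of \<open>A\<close> equals \<open>4 e(A) e(V - A) - c(A)\<^sup>2\<close>, which is symmetric in \<open>A\<close> and
  \<open>V - A\<close>. Hence the modularity is positive iff \<open>c(A)\<^sup>2 < 4 e(A) e(V - A)\<close> for some \<open>A\<close>.
  If \<open>A\<close> has \<open>p\<close> and \<open>k\<close> vertices in the two sides of \<open>K\<^bsub>s,t\<^esub>\<close>, the summand is
  \<open>- (p t - k s)\<^sup>2\<close>; choosing \<open>p\<close> about \<open>s / 2\<close> and \<open>k\<close> about \<open>p t / s\<close> makes it so small that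
  deleting one crossing edge, or adding one edge outside \<open>A\<close>, makes it positive.
\<close>

section \<open>Positive modularity\<close>

definition crossing :: "'a set set \<Rightarrow> 'a set \<Rightarrow> nat" where
  "crossing E A = card {e \<in> E. e \<inter> A \<noteq> {} \<and> \<not> e \<subseteq> A}"

lemma simple_graph_finite_edges: "simple_graph V E \<Longrightarrow> finite E"
  unfolding simple_graph_def by (meson finite_imp_finite_nsets finite_subset)

lemma simple_graph_edge:
  assumes "simple_graph V E" "e \<in> E"
  shows "e \<subseteq> V" "finite e" "card e = 2"
  using assms by (auto simp: simple_graph_def nsets_def)

lemma simple_graph_mono: "simple_graph V E \<Longrightarrow> F \<subseteq> E \<Longrightarrow> simple_graph V F"
  by (auto simp: simple_graph_def)

text \<open>Double counting of incidences between \<open>A\<close> and the edges: an edge inside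
  \<open>A\<close> has two ends there, a crossing edge one, and any other edge none.\<close>

lemma vol_eq:
  assumes G: "simple_graph V E" and "A \<subseteq> V"
  shows "vol E A = 2 * edges_within E A + crossing E A"
proof -
  have fin: "finite E" "finite A"
    using assms simple_graph_finite_edges finite_subset by (auto simp: simple_graph_def)
  have "vol E A = (\<Sum>v\<in>A. \<Sum>e\<in>E. of_bool (v \<in> e))"
    using fin by (simp add: vol_def vertex_degree_def Int_def)
  also have "\<dots> = (\<Sum>e\<in>E. \<Sum>v\<in>A. of_bool (v \<in> e))"
    by (rule sum.swap)
  also have "\<dots> = (\<Sum>e\<in>E. 2 * of_bool (e \<subseteq> A) + of_bool (e \<inter> A \<noteq> {} \<and> \<not> e \<subseteq> A))"
  proof (rule sum.cong)
    fix e assume e: "e \<in> E"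
    then obtain x y where "e = {x, y}" "x \<noteq> y"
      using simple_graph_edge[OF G e] by (meson card_2_iff)
    then have "card (A \<inter> e) = 2 * of_bool (e \<subseteq> A) + of_bool (e \<inter> A \<noteq> {} \<and> \<not> e \<subseteq> A)"
      by (cases "x \<in> A"; cases "y \<in> A") auto
    then show "(\<Sum>v\<in>A. of_bool (v \<in> e) :: nat) = 2 * of_bool (e \<subseteq> A) + of_bool (e \<inter> A \<noteq> {} \<and> \<not> e \<subseteq> A)"
      using fin by (simp add: Int_def)
  qed simp
  also have "\<dots> = 2 * edges_within E A + crossing E A"
    using fin by (simp add: sum.distrib flip: sum_distrib_left)
      (simp add: edges_within_def crossing_def Int_def)
  finally show ?thesis .
qed

lemma card_edges_eq:
  assumes G: "simple_graph V E" and "A \<subseteq> V"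
  shows "card E = edges_within E A + edges_within E (V - A) + crossing E A"
proof -
  have fin: "finite E" using G by (rule simple_graph_finite_edges)
  have "card E = (\<Sum>e\<in>E. of_bool (e \<subseteq> A) + of_bool (e \<subseteq> V - A) +
      of_bool (e \<inter> A \<noteq> {} \<and> \<not> e \<subseteq> A))"
    unfolding card_eq_sum
  proof (rule sum.cong)
    fix e assume "e \<in> E"
    then have "e \<subseteq> V" "e \<noteq> {}" using simple_graph_edge[OF G] by fastforce+
    then show "1 = of_bool (e \<subseteq> A) + of_bool (e \<subseteq> V - A) +
        (of_bool (e \<inter> A \<noteq> {} \<and> \<not> e \<subseteq> A) :: nat)"
      by (cases "e \<subseteq> A"; cases "e \<inter> A = {}") auto
  qed simp
  also have "\<dots> = edges_within E A + edges_within E (V - A) + crossing E A"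
    using fin by (simp add: sum.distrib edges_within_def crossing_def Int_def)
  finally show ?thesis .
qed

text \<open>Write e, f, c for the numbers of edges inside \<open>A\<close>, inside
  \<open>V - A\<close> and crossing. Then 4(e + f + c)e - (2e + c)^2 = 4ef - c^2, because the terms
  4e^2 and 4ec cancel.\<close>

lemma part_score_eq:
  assumes "simple_graph V E" "A \<subseteq> V"
  shows "4 * real (card E) * real (edges_within E A) - real (vol E A) ^ 2 =
    4 * real (edges_within E A) * real (edges_within E (V - A)) - real (crossing E A) ^ 2"
  unfolding vol_eq[OF assms] card_edges_eq[OF assms]
  by (simp add: power2_eq_square algebra_simps)

lemma modularity_score_eq:
  assumes "simple_graph V E" "partition_on V P" "E \<noteq> {}"
  shows "modularity_score E P = (\<Sum>A\<in>P. 4 * real (edges_within E A) * real (edges_within E (V - A))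
    - real (crossing E A) ^ 2) / (4 * real (card E) ^ 2)"
proof -
  have "card E > 0"
    using assms simple_graph_finite_edges by (metis card_gt_0_iff)
  then have "modularity_score E P =
    (\<Sum>A\<in>P. 4 * real (card E) * real (edges_within E A) - real (vol E A) ^ 2) / (4 * real (card E) ^ 2)"
    unfolding modularity_score_def sum_subtractf
    by (simp add: field_simps power2_eq_square flip: sum_distrib_left sum_distrib_right)
  also have "(\<Sum>A\<in>P. 4 * real (card E) * real (edges_within E A) - real (vol E A) ^ 2) =
    (\<Sum>A\<in>P. 4 * real (edges_within E A) * real (edges_within E (V - A)) - real (crossing E A) ^ 2)"
    using assms by (intro sum.cong refl part_score_eq) (auto simp: partition_on_def)
  finally show ?thesis .
qed

text \<open>A finite vertex set has finitely many partitions and at least one, the singletons, so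
  \<open>Max\<close> is attained.\<close>

lemma max_modularity_pos_iff_score:
  assumes G: "simple_graph V E"
  shows "max_modularity V E > 0 \<longleftrightarrow> E \<noteq> {} \<and> (\<exists>P. partition_on V P \<and> modularity_score E P > 0)"
proof (cases "E = {}")
  case False
  have "finite {P. partition_on V P}"
    using G by (simp add: finitely_many_partition_on simple_graph_def)
  then have "finite {modularity_score E P | P. partition_on V P}" by simp
  moreover have "\<exists>P. partition_on V P"
    using partition_on_singletons by (rule exI)
  then have "{modularity_score E P | P. partition_on V P} \<noteq> {}" by auto
  ultimately show ?thesis
    using False by (auto simp: max_modularity_def Max_gr_iff)
qed (simp add: max_modularity_def)

lemma crossing_Diff:
  assumes "simple_graph V E"
  shows "crossing E (V - A) = crossing E A"
proof -
  have "{e \<in> E. e \<inter> (V - A) \<noteq> {} \<and> \<not> e \<subseteq> V - A} = {e \<in> E. e \<inter> A \<noteq> {} \<and> \<not> e \<subseteq> A}"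
    using simple_graph_edge(1)[OF assms] by blast
  then show ?thesis by (simp add: crossing_def)
qed

lemma edges_within_empty: "simple_graph V E \<Longrightarrow> edges_within E {} = 0"
  using simple_graph_edge(3)[of V E "{}"] by (auto simp: edges_within_def)

section \<open>Cut criterion and its consequences\<close>

text \<open>A positive sum over the parts has a positive summand, and its part is the required
  \<open>A\<close>. Conversely, both parts of \<open>{A, V - A}\<close> have the same summand by
  symmetry, so that partition scores a positive multiple of it.\<close>

theorem max_modularity_pos_iff:
  assumes G: "simple_graph V E"
  shows "max_modularity V E > 0 \<longleftrightarrow>
    (\<exists>A\<subseteq>V. crossing E A ^ 2 < 4 * edges_within E A * edges_within E (V - A))"
proof
  assume "max_modularity V E > 0"
  then obtain P where P: "partition_on V P" "modularity_score E P > 0" and "E \<noteq> {}"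
    using max_modularity_pos_iff_score[OF G] by blast
  then have "(\<Sum>A\<in>P. 4 * real (edges_within E A) * real (edges_within E (V - A))
    - real (crossing E A) ^ 2) > 0"
    using G by (simp add: modularity_score_eq zero_less_divide_iff)
  then obtain A where "A \<in> P" and
    "4 * real (edges_within E A) * real (edges_within E (V - A)) - real (crossing E A) ^ 2 > 0"
    by (meson not_le sum_nonpos)
  then have "real (crossing E A ^ 2) < real (4 * edges_within E A * edges_within E (V - A))" by simp
  then have "crossing E A ^ 2 < 4 * edges_within E A * edges_within E (V - A)"
    unfolding of_nat_less_iff .
  with \<open>A \<in> P\<close> P(1) show "\<exists>A\<subseteq>V. crossing E A ^ 2 < 4 * edges_within E A * edges_within E (V - A)"
    by (auto simp: partition_on_def)
next
  assume "\<exists>A\<subseteq>V. crossing E A ^ 2 < 4 * edges_within E A * edges_within E (V - A)"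
  then obtain A where A: "A \<subseteq> V" "crossing E A ^ 2 < 4 * edges_within E A * edges_within E (V - A)"
    by blast
  \<comment> \<open>A partition may not contain the empty set. Neither side is empty, since a side
    without edges would make the right-hand product 0.\<close>
  have ne: "A \<noteq> {}" "V - A \<noteq> {}"
    using A(2) edges_within_empty[OF G] by (metis mult_zero_left mult_zero_right not_less_zero)+
  have "E \<noteq> {}" using A(2) by (auto simp: edges_within_def)
  have P: "partition_on V {A, V - A}"
    using A(1) ne by (auto simp: partition_on_def disjoint_def)
  have "A \<noteq> V - A" using ne by blast
  moreover have "V - (V - A) = A" using A(1) by blast
  moreover have "real (crossing E A ^ 2) < real (4 * edges_within E A * edges_within E (V - A))"
    using A(2) unfolding of_nat_less_iff .
  moreover have "card E > 0"
    using G \<open>E \<noteq> {}\<close> simple_graph_finite_edges by (metis card_gt_0_iff)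
  ultimately have "modularity_score E {A, V - A} > 0"
    by (simp add: modularity_score_eq[OF G P \<open>E \<noteq> {}\<close>] crossing_Diff[OF G] zero_less_divide_iff mult.commute mult.left_commute)
  then show "max_modularity V E > 0"
    using max_modularity_pos_iff_score[OF G] P \<open>E \<noteq> {}\<close> by blast
qed

text \<open>The two inner edge counts in the cut criterion must both be nonzero. This excludes every
  graph whose edges share a vertex.\<close>

lemma max_modularity_pos_disjoint_edges:
  assumes G: "simple_graph V E" and pos: "max_modularity V E > 0"
  obtains e f where "e \<in> E" "f \<in> E" "e \<inter> f = {}"
proof -
  obtain A where "crossing E A ^ 2 < 4 * edges_within E A * edges_within E (V - A)"
    using pos max_modularity_pos_iff[OF G] by blast
  then have "edges_within E A > 0" "edges_within E (V - A) > 0"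
    by (intro gr0I; simp)+
  then have "{e \<in> E. e \<subseteq> A} \<noteq> {}" "{e \<in> E. e \<subseteq> V - A} \<noteq> {}"
    by (auto simp: edges_within_def card_gt_0_iff)
  then show thesis using that by blast
qed

text \<open>Each side of the cut contains an edge, hence two vertices. With at most four vertices
  both sides have exactly two, so each contains exactly one edge, and c^2 < 4 allows at most one
  crossing edge.\<close>

lemma max_modularity_pos_card_edges:
  assumes G: "simple_graph V E" and pos: "max_modularity V E > 0" and V: "card V \<le> 4"
  shows "card V = 4" "card E \<le> 3"
proof -
  have finV: "finite V" and finE: "finite E"
    using G simple_graph_finite_edges by (auto simp: simple_graph_def)
  obtain A where A: "A \<subseteq> V" "crossing E A ^ 2 < 4 * edges_within E A * edges_within E (V - A)"
    using pos max_modularity_pos_iff[OF G] by blast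
  have fin: "finite A" "finite (V - A)" using finV A(1) finite_subset by auto
  have 0: "edges_within E A \<noteq> 0" "edges_within E (V - A) \<noteq> 0"
    using A(2) by (intro notI; simp)+
  have ge: "card B \<ge> 2" if B: "edges_within E B \<noteq> 0" "finite B" for B
  proof -
    obtain e where e: "e \<in> E" "e \<subseteq> B"
      using B(1) by (auto simp: edges_within_def card_eq_0_iff)
    then show ?thesis
      using simple_graph_edge(3)[OF G e(1)] card_mono[OF B(2) e(2)] by simp
  qed
  have le: "edges_within E B \<le> 1" if "card B = 2" "finite B" for B
  proof -
    have "e = B" if "e \<in> E" "e \<subseteq> B" for e
      using card_subset_eq[OF \<open>finite B\<close> that(2)] simple_graph_edge(3)[OF G that(1)] \<open>card B = 2\<close>
      by simp
    then have "{e \<in> E. e \<subseteq> B} \<subseteq> {B}" by blast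
    then show ?thesis unfolding edges_within_def using card_mono[of "{B}"] by simp
  qed
  have "card V = card A + card (V - A)"
    using A(1) fin card_mono[OF finV A(1)] by (simp add: card_Diff_subset)
  then have c: "card A = 2" "card (V - A) = 2" "card V = 4"
    using V ge[OF 0(1) fin(1)] ge[OF 0(2) fin(2)] by linarith+
  then show "card V = 4" by simp
  have 1: "edges_within E A = 1" "edges_within E (V - A) = 1"
    using le[OF c(1) fin(1)] le[OF c(2) fin(2)] 0 by linarith+
  with A(2) have "crossing E A ^ 2 < 2 ^ 2" by simp
  then have "crossing E A < 2" by (rule power_less_imp_less_base) simp
  with card_edges_eq[OF G A(1)] 1 show "card E \<le> 3" by simp
qed

section \<open>Edits of complete bipartite graphs\<close>

text \<open>Both sides are explicit parameters because the edges inside a vertex set, and the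
  crossing edges, are again described by bicliques between pieces of \<open>X\<close> and
  \<open>Y\<close>.\<close>

definition biclique :: "'a set \<Rightarrow> 'a set \<Rightarrow> 'a set set" where
  "biclique X Y = {{x, y} | x y. x \<in> X \<and> y \<in> Y}"

lemma biclique_iff: "e \<in> biclique X Y \<longleftrightarrow> (\<exists>x\<in>X. \<exists>y\<in>Y. e = {x, y})"
  by (auto simp: biclique_def)

lemma card_biclique:
  assumes "X \<inter> Y = {}"
  shows "card (biclique X Y) = card X * card Y"
proof -
  have "biclique X Y = (\<lambda>(x, y). {x, y}) ` (X \<times> Y)" by (auto simp: biclique_def)
  moreover have "inj_on (\<lambda>(x, y). {x, y}) (X \<times> Y)"
    using assms by (fastforce simp: inj_on_def doubleton_eq_iff)
  ultimately show ?thesis by (simp add: card_image card_cartesian_product)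
qed

lemma finite_biclique: "finite X \<Longrightarrow> finite Y \<Longrightarrow> finite (biclique X Y)"
  by (simp add: biclique_def finite_image_set2)

lemma edges_within_biclique:
  assumes "X \<inter> Y = {}"
  shows "edges_within (biclique X Y) A = card (X \<inter> A) * card (Y \<inter> A)"
proof -
  have "{e \<in> biclique X Y. e \<subseteq> A} = biclique (X \<inter> A) (Y \<inter> A)"
    by (auto simp: biclique_def)
  moreover have "(X \<inter> A) \<inter> (Y \<inter> A) = {}" using assms by blast
  ultimately show ?thesis by (simp add: edges_within_def card_biclique)
qed

lemma crossing_biclique:
  assumes "X \<inter> Y = {}" "finite X" "finite Y"
  shows "crossing (biclique X Y) A = card (X \<inter> A) * card (Y - A) + card (X - A) * card (Y \<inter> A)"
proof -
  have "{e \<in> biclique X Y. e \<inter> A \<noteq> {} \<and> \<not> e \<subseteq> A} =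
      biclique (X \<inter> A) (Y - A) \<union> biclique (X - A) (Y \<inter> A)"
    by (auto simp: biclique_iff) blast+
  moreover have "biclique (X \<inter> A) (Y - A) \<inter> biclique (X - A) (Y \<inter> A) = {}"
    using assms by (auto simp: biclique_iff doubleton_eq_iff) blast+
  moreover have "(X \<inter> A) \<inter> (Y - A) = {}" "(X - A) \<inter> (Y \<inter> A) = {}" using assms by blast+
  ultimately show ?thesis
    using assms by (simp add: crossing_def card_Un_disjoint finite_biclique card_biclique)
qed

section \<open>Effect of one edge on the cut counts\<close>

lemma edges_within_insert:
  assumes "finite E" "e \<notin> E" "e \<subseteq> A"
  shows "edges_within (insert e E) A = Suc (edges_within E A)"
proof -
  have "{f \<in> insert e E. f \<subseteq> A} = insert e {f \<in> E. f \<subseteq> A}" using assms by blast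
  then show ?thesis using assms by (simp add: edges_within_def)
qed

lemma edges_within_insert_other:
  assumes "\<not> e \<subseteq> A"
  shows "edges_within (insert e E) A = edges_within E A"
  unfolding edges_within_def using assms by (intro arg_cong[where f = card]) auto

lemma crossing_insert_disjoint:
  assumes "e \<inter> A = {}"
  shows "crossing (insert e E) A = crossing E A"
  unfolding crossing_def using assms by (intro arg_cong[where f = card]) auto

lemma edges_within_remove_other:
  assumes "\<not> e \<subseteq> A"
  shows "edges_within (E - {e}) A = edges_within E A"
  unfolding edges_within_def using assms by (intro arg_cong[where f = card]) auto

lemma crossing_remove:
  assumes "e \<in> E" "e \<inter> A \<noteq> {}" "\<not> e \<subseteq> A"
  shows "crossing (E - {e}) A = crossing E A - 1"
proof -
  have "{f \<in> E - {e}. f \<inter> A \<noteq> {} \<and> \<not> f \<subseteq> A} = {f \<in> E. f \<inter> A \<noteq> {} \<and> \<not> f \<subseteq> A} - {e}" by blast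
  then show ?thesis using assms by (simp add: crossing_def)
qed

section \<open>Complete bipartite graphs and substars have no positive modularity\<close>

lemma complete_bipartite_biclique:
  assumes "complete_bipartite s t V E"
  obtains X Y where "finite X" "finite Y" "X \<inter> Y = {}" "card X = s" "card Y = t"
    "V = X \<union> Y" "E = biclique X Y"
  using assms unfolding complete_bipartite_def biclique_def by blast

lemma complete_bipartite_card:
  assumes "complete_bipartite s t V E"
  shows "card V = s + t" "card E = s * t"
proof -
  obtain X Y where "finite X" "finite Y" "X \<inter> Y = {}" "card X = s" "card Y = t"
    "V = X \<union> Y" "E = biclique X Y"
    using complete_bipartite_biclique[OF assms] .
  then show "card V = s + t" "card E = s * t"
    by (simp_all add: card_Un_disjoint card_biclique)
qed

text \<open>Let \<open>A\<close> split the two sides into p + a and k + b vertices, with p and k in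
  \<open>A\<close>. The criterion would read (pb + ak)^2 < 4(pk)(ab), that is, (pb - ak)^2 <
  0.\<close>

lemma complete_bipartite_not_pos:
  assumes K: "complete_bipartite s t V E"
  shows "\<not> max_modularity V E > 0"
proof
  assume "max_modularity V E > 0"
  then obtain A where A: "A \<subseteq> V" "crossing E A ^ 2 < 4 * edges_within E A * edges_within E (V - A)"
    using max_modularity_pos_iff[OF complete_bipartite_simple_graph[OF K]] by blast
  obtain X Y where XY: "finite X" "finite Y" "X \<inter> Y = {}" "V = X \<union> Y" "E = biclique X Y"
    using complete_bipartite_biclique[OF K] by metis
  have "X \<inter> (V - A) = X - A" "Y \<inter> (V - A) = Y - A" using XY by blast+
  with A(2) XY have "(card (X \<inter> A) * card (Y - A) + card (X - A) * card (Y \<inter> A)) ^ 2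
      < 4 * (card (X \<inter> A) * card (Y \<inter> A)) * (card (X - A) * card (Y - A))"
    by (simp add: crossing_biclique edges_within_biclique)
  then have "int ((card (X \<inter> A) * card (Y - A) + card (X - A) * card (Y \<inter> A)) ^ 2)
      < int (4 * (card (X \<inter> A) * card (Y \<inter> A)) * (card (X - A) * card (Y - A)))"
    unfolding of_nat_less_iff .
  then have "(int (card (X \<inter> A)) * int (card (Y - A)) - int (card (X - A)) * int (card (Y \<inter> A))) ^ 2 < 0"
    by (simp add: power2_eq_square algebra_simps)
  then show False by (simp add: not_less[symmetric])
qed

text \<open>All edges contain the centre \<open>c\<close>, so no two of them are disjoint.\<close>

lemma star_subgraph_not_pos:
  assumes K: "complete_bipartite 1 t V E" and "F \<subseteq> E"
  shows "\<not> max_modularity V F > 0"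
proof
  assume pos: "max_modularity V F > 0"
  obtain X Y where "card X = 1" "E = biclique X Y"
    using complete_bipartite_biclique[OF K] by metis
  moreover from this obtain c where "X = {c}" by (auto simp: card_1_singleton_iff)
  ultimately have "\<forall>e\<in>F. c \<in> e" using \<open>F \<subseteq> E\<close> by (auto simp: biclique_iff)
  moreover have "simple_graph V F"
    using complete_bipartite_simple_graph[OF K] \<open>F \<subseteq> E\<close> by (rule simple_graph_mono)
  ultimately show False using max_modularity_pos_disjoint_edges[OF _ pos] by blast
qed

section \<open>Deleting one edge across a balanced cut\<close>

text \<open>These are the bounds for the nearly proportional split used for deletions and additions
  alike: p = floor(s/2) vertices of one side and k = floor(pt/s) of the other. The first bound comes
  from s \<le> t, the second from 2p \<le> s.\<close>

lemma half_times_div_bounds: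
  fixes s t :: nat
  assumes "0 < s" "s \<le> t"
  shows "s div 2 \<le> s div 2 * t div s" "2 * (s div 2 * t div s) \<le> t"
proof -
  have "s div 2 * s \<le> s div 2 * t" using assms by simp
  then show "s div 2 \<le> s div 2 * t div s"
    using assms by (metis div_le_mono nonzero_mult_div_cancel_right less_not_refl2)
  have "s * (2 * (s div 2 * t div s)) \<le> 2 * (s div 2 * t)"
    using times_div_less_eq_dividend[of s "s div 2 * t"] by linarith
  also have "\<dots> = 2 * (s div 2) * t" by simp
  also have "\<dots> \<le> s * t" by (intro mult_le_mono1) simp
  finally show "2 * (s div 2 * t div s) \<le> t"
    using assms(1) by (simp only: mult_le_cancel1)
qed

text \<open>The subtracted 1 is the deleted crossing edge. The bounds \<open>0 < a\<close> and
  \<open>b < t\<close> guarantee that an edge from the \<open>X\<close> vertices in the cut to the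
  \<open>Y\<close> vertices outside it exists.\<close>

lemma balanced_split_remove:
  fixes s t :: nat
  assumes "2 \<le> s" "s \<le> t"
  obtains a b where "0 < a" "a \<le> s" "b < t"
    "(a * (t - b) + (s - a) * b - 1) ^ 2 < 4 * (a * b) * ((s - a) * (t - b))"
proof -
  define a where "a = s div 2"
  define b where "b = a * t div s"
  define d where "d = a * t mod s"
  have d: "d < s" using assms by (simp add: d_def)
  have eq: "a * t = s * b + d" by (simp add: b_def d_def)
  have a: "0 < a" "2 * a \<le> s" "s \<le> 2 * a + 1" using assms by (auto simp: a_def)
  have ab: "a \<le> b" and bt: "2 * b \<le> t"
    using half_times_div_bounds[of s t] assms by (simp_all add: a_def b_def)
  obtain p where p: "s = a + p" using a(2) le_Suc_ex[of a s] by auto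
  obtain k where k: "t = b + k" using bt le_Suc_ex[of b t] by auto
  have pa: "a \<le> p" "p \<le> a + 1" using a p by auto
  \<comment> \<open>The two kinds of crossing edges number x + d and x. Before the deletion c = 2x +
    d, while the product of the inner counts is x(x + d), so c^2 exceeds four times that product by
    exactly d^2.\<close>
  define x where "x = p * b"
  have ak: "a * k = x + d" using eq unfolding p k x_def by (simp add: algebra_simps)
  have "p = a \<or> p = a + 1" using a p by linarith
  then have "s ^ 2 \<le> 4 * (a * p) + 1"
    unfolding p by (auto simp: power2_eq_square algebra_simps)
  moreover have "a * p \<le> x" using ab by (simp add: x_def)
  moreover have "d ^ 2 \<le> (s - 1) ^ 2" using d by (intro power_mono) auto
  moreover have "(s - 1) ^ 2 + 2 * s = s ^ 2 + 1"
    using assms(1) by (cases s) (simp_all add: power2_eq_square)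
  \<comment> \<open>This is (2x + d - 1)^2 < 4x(x + d) after expansion. The facts above give d^2 + 1
    \<le> 4x + 3 - 2s, and 3 - 2s is negative for s \<ge> 2.\<close>
  ultimately have "d ^ 2 + 1 < 4 * x + 2 * d" using assms(1) by linarith
  then have small: "int (d ^ 2 + 1) < int (4 * x + 2 * d)" by (simp only: of_nat_less_iff)
  have "0 < x" using a p ab by (auto simp: x_def)
  \<comment> \<open>There is a crossing edge, so the subtraction of 1 on natural numbers does not
    truncate.\<close>
  then have "a * k + p * b \<noteq> 0" by (simp add: x_def)
  then obtain N where N: "a * k + p * b = Suc N" using not0_implies_Suc by blast
  then have int_N: "int N = 2 * int x + int d - 1" using ak x_def by linarith
  have "int (N ^ 2) < int (4 * x * (x + d))"
    using small by (simp add: int_N power2_eq_square algebra_simps)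
  then have "N ^ 2 < 4 * x * (x + d)" by (simp only: of_nat_less_iff)
  also have "\<dots> = 4 * (a * b) * (p * k)"
    unfolding ak[symmetric] unfolding x_def by (simp add: ac_simps)
  finally have "N ^ 2 < 4 * (a * b) * (p * k)" .
  then have "(a * (t - b) + (s - a) * b - 1) ^ 2 < 4 * (a * b) * ((s - a) * (t - b))"
    using N p k by simp
  moreover have "b < t" using bt assms by linarith
  ultimately show thesis using that a by auto
qed

text \<open>Deleting an edge that crosses the balanced cut lowers the crossing count by one and
  leaves both inner counts unchanged.\<close>

lemma complete_bipartite_remove_pos:
  assumes K: "complete_bipartite s t V E" and "2 \<le> s" "s \<le> t"
  obtains e where "e \<in> E" "max_modularity V (E - {e}) > 0"
proof -
  obtain X Y where XY: "finite X" "finite Y" "X \<inter> Y = {}" "card X = s" "card Y = t"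
    "V = X \<union> Y" "E = biclique X Y"
    using complete_bipartite_biclique[OF K] by metis
  obtain a b where ab: "0 < a" "a \<le> s" "b < t"
    "(a * (t - b) + (s - a) * b - 1) ^ 2 < 4 * (a * b) * ((s - a) * (t - b))"
    using balanced_split_remove[OF assms(2,3)] by metis
  obtain S where S: "S \<subseteq> X" "card S = a" using ab XY by (metis obtain_subset_with_card_n)
  obtain T where T: "T \<subseteq> Y" "card T = b" using ab XY by (metis less_imp_le obtain_subset_with_card_n)
  obtain u where u: "u \<in> S" using S ab by fastforce
  have "T \<noteq> Y" using T ab XY by auto
  then obtain v where v: "v \<in> Y" "v \<notin> T" using T by blast
  define A where "A = S \<union> T"
  have sets: "X \<inter> A = S" "Y \<inter> A = T" "X - A = X - S" "Y - A = Y - T"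
    "X \<inter> (V - A) = X - S" "Y \<inter> (V - A) = Y - T"
    using XY S T by (auto simp: A_def)
  have cards: "card (X - S) = s - a" "card (Y - T) = t - b"
    using XY S T by (auto simp: card_Diff_subset finite_subset)
  let ?e = "{u, v}"
  have e: "?e \<in> E" "u \<in> A" "v \<notin> A" using u v S XY by (auto simp: biclique_iff A_def)
  then have eA: "?e \<inter> A \<noteq> {}" "\<not> ?e \<subseteq> A" "\<not> ?e \<subseteq> V - A" by auto
  have "crossing (E - {?e}) A ^ 2 < 4 * edges_within (E - {?e}) A * edges_within (E - {?e}) (V - A)"
    unfolding crossing_remove[OF e(1) eA(1,2)] edges_within_remove_other[OF eA(2)]
      edges_within_remove_other[OF eA(3)]
    using XY sets cards S T ab(4) by (simp add: crossing_biclique edges_within_biclique)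
  moreover have "simple_graph V (E - {?e})"
    using complete_bipartite_simple_graph[OF K] simple_graph_mono by (metis Diff_subset)
  moreover have "A \<subseteq> V" using S T XY by (auto simp: A_def)
  ultimately show thesis using that e(1) max_modularity_pos_iff by blast
qed

section \<open>Adding one edge beside a balanced cut\<close>

text \<open>The added 1 is the new edge outside the cut set, and \<open>k + 2 \<le> t\<close> leaves
  two vertices of the larger side there to carry it.\<close>

lemma balanced_split_add:
  fixes s t :: nat
  assumes "s = 1 \<and> 4 \<le> t \<or> 2 \<le> s \<and> 3 \<le> t" "s \<le> t"
  obtains p k where "p \<le> s" "k + 2 \<le> t"
    "(p * (t - k) + (s - p) * k) ^ 2 < 4 * (p * k) * ((s - p) * (t - k) + 1)"
proof -
  note result = that
  \<comment> \<open>The new edge gains 4pk on the right, while the original deficit is (pt - ks)^2;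
    it suffices that the gain exceeds the deficit.\<close>
  have *: thesis if "p \<le> s" "k + 2 \<le> t" "(int p * int t - int k * int s) ^ 2 < 4 * (int p * int k)" for p k
  proof -
    obtain a where a: "s = p + a" using \<open>p \<le> s\<close> le_Suc_ex by auto
    obtain b where b: "t = k + b" using \<open>k + 2 \<le> t\<close> le_Suc_ex[of k t] by auto
    have "int ((p * b + a * k) ^ 2) < int (4 * (p * k) * (a * b + 1))"
      using that(3) unfolding a b by (simp add: power2_eq_square algebra_simps)
    then have "(p * b + a * k) ^ 2 < 4 * (p * k) * (a * b + 1)" by (simp only: of_nat_less_iff)
    then show thesis using result[OF that(1,2)] a b by simp
  qed
  show thesis
  proof (cases "s = 1")
    case True
    \<comment> \<open>With p = 1 and k = t - 2 the deficit is 2^2, and the gain 4(t - 2) exceeds it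
      exactly when t \<ge> 4.\<close>
    then show thesis using assms by (intro *[of 1 "t - 2"]) (auto simp: of_nat_diff)
  next
    case False
    then have s: "2 \<le> s" "3 \<le> t" using assms by auto
    define p where "p = s div 2"
    define k where "k = p * t div s"
    define d where "d = p * t mod s"
    have d: "d < s" using s by (simp add: d_def)
    have eq: "p * t = s * k + d" by (simp add: k_def d_def)
    have p: "0 < p" "2 * p \<le> s" "s \<le> 2 * p + 1" using s by (auto simp: p_def)
    have pk: "p \<le> k" and kt: "2 * k \<le> t"
      using half_times_div_bounds[of s t] s assms(2) by (simp_all add: p_def k_def)
    show thesis
    \<comment> \<open>Here the deficit of the rounded split is d^2 with d \<le> 2p and p \<le> k, so
      d^2 < 4pk can fail only by equality in both bounds. That forces s = 2p + 1 and t = 2p + 3,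
      where rounding up to k = p + 1 reduces the deficit to 1.\<close>
    proof (cases "d = 2 * p \<and> k = p")
      case True
      then have "s = 2 * p + 1" using d p by linarith
      moreover from this have "p * t = p * (s + 2)" using eq True by (simp add: algebra_simps)
      then have "t = s + 2" using p(1) unfolding mult_cancel1 by simp
      ultimately have st: "s = 2 * p + 1" "t = 2 * p + 3" by simp_all
      have "int p * int t - int (p + 1) * int s = - 1"
        by (simp add: st algebra_simps)
      moreover have "0 < int p * int (p + 1)" using p(1) by simp
      ultimately have "(int p * int t - int (p + 1) * int s) ^ 2 < 4 * (int p * int (p + 1))" by simp
      then show thesis using p(1) by (intro *[of p "p + 1"]) (simp_all add: st)
    next
      case False
      have "d ^ 2 < 4 * (p * k)"
      proof (cases "d < 2 * p")
        case True
        then have "d ^ 2 < (2 * p) ^ 2" by (intro power_strict_mono) auto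
        also have "\<dots> \<le> 4 * (p * k)" using pk by (simp add: power2_eq_square)
        finally show ?thesis .
      next
        case F: False
        then have "d = 2 * p" using d p by linarith
        with False pk have "p < k" by simp
        with \<open>d = 2 * p\<close> p(1) show ?thesis by (simp add: power2_eq_square)
      qed
      moreover have "int p * int t - int k * int s = int d"
        using eq by (metis add_diff_cancel_left' mult.commute of_nat_add of_nat_mult)
      ultimately have "(int p * int t - int k * int s) ^ 2 < 4 * (int p * int k)"
        by (metis of_nat_less_iff of_nat_mult of_nat_numeral of_nat_power)
      \<comment> \<open>Since t - k \<ge> t/2 \<ge> 3/2, the integer t - k is at least 2.\<close>
      moreover have "k + 2 \<le> t" using kt s by linarith
      moreover have "p \<le> s" using p by linarith
      ultimately show thesis using * by blast
    qed
  qed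
qed

text \<open>The new edge joins two vertices of \<open>Y\<close> outside the cut set: it is no edge
  of the bipartite graph, and it changes only the inner count of \<open>V - A\<close>.\<close>

lemma complete_bipartite_add_pos:
  assumes K: "complete_bipartite s t V E" and st: "s = 1 \<and> 4 \<le> t \<or> 2 \<le> s \<and> 3 \<le> t" "s \<le> t"
  obtains e where "e \<in> nsets V 2 - E" "max_modularity V (insert e E) > 0"
proof -
  obtain X Y where XY: "finite X" "finite Y" "X \<inter> Y = {}" "card X = s" "card Y = t"
    "V = X \<union> Y" "E = biclique X Y"
    using complete_bipartite_biclique[OF K] by metis
  obtain p k where pk: "p \<le> s" "k + 2 \<le> t"
    "(p * (t - k) + (s - p) * k) ^ 2 < 4 * (p * k) * ((s - p) * (t - k) + 1)"
    using balanced_split_add[OF st] by metis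
  obtain S where S: "S \<subseteq> X" "card S = p" using pk XY by (metis obtain_subset_with_card_n)
  obtain T where T: "T \<subseteq> Y" "card T = k"
    using pk XY by (metis add_leD1 obtain_subset_with_card_n)
  define A where "A = S \<union> T"
  have sets: "X \<inter> A = S" "Y \<inter> A = T" "X - A = X - S" "Y - A = Y - T"
    "X \<inter> (V - A) = X - S" "Y \<inter> (V - A) = Y - T"
    using XY S T by (auto simp: A_def)
  have cards: "card (X - S) = s - p" "card (Y - T) = t - k"
    using XY S T by (auto simp: card_Diff_subset finite_subset)
  then have "2 \<le> card (Y - T)" using pk by simp
  then obtain e where e: "e \<subseteq> Y - T" "card e = 2" by (metis obtain_subset_with_card_n)
  have "e \<noteq> {}" using e(2) by auto
  have fe: "finite e" using e(2) by (metis card.infinite zero_neq_numeral)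
  have "e \<notin> E" using e(1) XY by (auto simp: biclique_iff)
  then have eV: "e \<in> nsets V 2 - E" using e fe XY by (auto simp: nsets_def)
  have eA: "e \<inter> A = {}" "\<not> e \<subseteq> A" "e \<subseteq> V - A"
    using e(1) \<open>e \<noteq> {}\<close> XY S by (auto simp: A_def)
  have finE: "finite E" using XY finite_biclique by auto
  have "crossing (insert e E) A ^ 2 < 4 * edges_within (insert e E) A * edges_within (insert e E) (V - A)"
    unfolding crossing_insert_disjoint[OF eA(1)] edges_within_insert_other[OF eA(2)]
      edges_within_insert[OF finE \<open>e \<notin> E\<close> eA(3)]
    using XY sets cards S T pk(3) by (simp add: crossing_biclique edges_within_biclique)
  moreover have "simple_graph V (insert e E)"
    using complete_bipartite_simple_graph[OF K] eV by (auto simp: simple_graph_def)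
  moreover have "A \<subseteq> V" using S T XY by (auto simp: A_def)
  ultimately show thesis using that eV max_modularity_pos_iff by blast
qed

section \<open>Edit distances\<close>

text \<open>The distances that count deleted or added edges are first reindexed by the size
  \<open>k\<close>, so that all three have this shape.\<close>

lemma Inf_enat_eqI:
  assumes "P n" "\<And>k. P k \<Longrightarrow> n \<le> k"
  shows "Inf {enat k | k. P k} = enat n"
  using assms by (intro antisym Inf_lower Inf_greatest) auto

lemma delta_minus_eq_1:
  assumes G: "simple_graph V E" and 0: "\<not> max_modularity V E > 0"
    and e: "e \<in> E" "max_modularity V (E - {e}) > 0"
  shows "delta_minus V E = 1"
proof -
  have "delta_minus V E = Inf {enat k | k. \<exists>D. k = card D \<and> D \<subseteq> E \<and> max_modularity V (E - D) > 0}"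
    unfolding delta_minus_def by (rule arg_cong[where f = Inf]) blast
  also have "\<dots> = enat 1"
  proof (rule Inf_enat_eqI)
    show "\<exists>D. 1 = card D \<and> D \<subseteq> E \<and> max_modularity V (E - D) > 0"
      using e by (intro exI[of _ "{e}"]) auto
  next
    fix k assume "\<exists>D. k = card D \<and> D \<subseteq> E \<and> max_modularity V (E - D) > 0"
    then obtain D where D: "k = card D" "D \<subseteq> E" "max_modularity V (E - D) > 0" by blast
    have "D \<noteq> {}" using D(3) 0 by auto
    \<comment> \<open>An infinite set would have \<open>card\<close> 0, so nonemptiness alone does
      not give the bound.\<close>
    moreover have "finite D" using D(2) simple_graph_finite_edges[OF G] finite_subset by blast
    ultimately show "1 \<le> k" using D(1) by (simp add: Suc_le_eq card_gt_0_iff)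
  qed
  finally show ?thesis by (simp add: one_enat_def)
qed

lemma delta_plus_eq_1:
  assumes G: "simple_graph V E" and 0: "\<not> max_modularity V E > 0"
    and e: "e \<in> nsets V 2 - E" "max_modularity V (insert e E) > 0"
  shows "delta_plus V E = 1"
proof -
  have "delta_plus V E =
    Inf {enat k | k. \<exists>F. k = card F \<and> F \<subseteq> nsets V 2 - E \<and> max_modularity V (E \<union> F) > 0}"
    unfolding delta_plus_def by (rule arg_cong[where f = Inf]) blast
  also have "\<dots> = enat 1"
  proof (rule Inf_enat_eqI)
    show "\<exists>F. 1 = card F \<and> F \<subseteq> nsets V 2 - E \<and> max_modularity V (E \<union> F) > 0"
      using e by (intro exI[of _ "{e}"]) auto
  next
    fix k assume "\<exists>F. k = card F \<and> F \<subseteq> nsets V 2 - E \<and> max_modularity V (E \<union> F) > 0"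
    then obtain F where F: "k = card F" "F \<subseteq> nsets V 2 - E" "max_modularity V (E \<union> F) > 0" by blast
    have "F \<noteq> {}" using F(3) 0 by auto
    moreover have "finite F"
      using F(2) G by (meson Diff_subset finite_imp_finite_nsets finite_subset simple_graph_def)
    ultimately show "1 \<le> k" using F(1) by (simp add: Suc_le_eq card_gt_0_iff)
  qed
  finally show ?thesis by (simp add: one_enat_def)
qed

lemma delta_eq_1:
  assumes 0: "\<not> max_modularity V E > 0"
    and E': "(E, E') \<in> edit_step V" "max_modularity V E' > 0"
  shows "delta V E = 1"
proof -
  have "delta V E = enat 1"
    unfolding delta_def
  proof (rule Inf_enat_eqI)
    show "\<exists>E'. (E, E') \<in> edit_step V ^^ 1 \<and> max_modularity V E' > 0" using E' by auto
  next
    fix k assume "\<exists>E'. (E, E') \<in> edit_step V ^^ k \<and> max_modularity V E' > 0"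
    then show "1 \<le> k" using 0 by (cases k) auto
  qed
  then show ?thesis by (simp add: one_enat_def)
qed

lemma delta_minus_eq_infinity:
  assumes "\<And>F. F \<subseteq> E \<Longrightarrow> \<not> max_modularity V F > 0"
  shows "delta_minus V E = \<infinity>"
proof -
  have "{enat (card D) | D. D \<subseteq> E \<and> max_modularity V (E - D) > 0} = {}"
    using assms by blast
  then show ?thesis unfolding delta_minus_def by (metis Inf_empty top_enat_def)
qed

lemma delta_plus_eq_infinity:
  assumes G: "simple_graph V E"
    and "\<And>F. simple_graph V F \<Longrightarrow> E \<subseteq> F \<Longrightarrow> \<not> max_modularity V F > 0"
  shows "delta_plus V E = \<infinity>"
proof -
  have "\<not> max_modularity V (E \<union> F) > 0" if "F \<subseteq> nsets V 2 - E" for F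
    using that G by (intro assms(2)) (auto simp: simple_graph_def)
  then have "{enat (card F) | F. F \<subseteq> nsets V 2 - E \<and> max_modularity V (E \<union> F) > 0} = {}"
    by blast
  then show ?thesis unfolding delta_plus_def by (metis Inf_empty top_enat_def)
qed

lemma edit_steps_simple_graph:
  "(E, E') \<in> edit_step V ^^ k \<Longrightarrow> simple_graph V E \<Longrightarrow> simple_graph V E'"
  by (induction k arbitrary: E') (auto intro: edit_step_simple_graph)

text \<open>Edit sequences never leave the simple graphs on \<open>V\<close>, so if none of these
  qualifies, the infimum is taken over the empty set.\<close>

lemma delta_eq_infinity:
  assumes G: "simple_graph V E"
    and "\<And>F. simple_graph V F \<Longrightarrow> \<not> max_modularity V F > 0"
  shows "delta V E = \<infinity>"
proof -
  have "{enat k | k. \<exists>E'. (E, E') \<in> edit_step V ^^ k \<and> max_modularity V E' > 0} = {}"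
    using assms edit_steps_simple_graph by blast
  then show ?thesis unfolding delta_def by (metis Inf_empty top_enat_def)
qed

section \<open>The claw, and the case distinction\<close>

text \<open>On four vertices positivity permits at most three edges, and the claw already has three,
  so \<open>F\<close> would be the claw itself.\<close>

lemma claw_supergraph_not_pos:
  assumes K: "complete_bipartite 1 3 V E" and F: "simple_graph V F" "E \<subseteq> F"
  shows "\<not> max_modularity V F > 0"
proof
  assume pos: "max_modularity V F > 0"
  have "card F \<le> 3"
    using max_modularity_pos_card_edges[OF F(1) pos] complete_bipartite_card[OF K] by simp
  then have "F = E"
    using F complete_bipartite_card(2)[OF K] simple_graph_finite_edges[OF F(1)]
    by (metis card_seteq mult_1)
  then show False using complete_bipartite_not_pos[OF K] pos by simp
qed

lemma delta_claw:
  assumes K: "complete_bipartite 1 3 V E"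
  shows "delta V E = 2"
proof -
  note G = complete_bipartite_simple_graph[OF K]
  have "delta V E = enat 2"
    unfolding delta_def
  proof (rule Inf_enat_eqI)
    obtain X Y where XY: "X \<inter> Y = {}" "card X = 1" "card Y = 3" "V = X \<union> Y" "E = biclique X Y"
      using complete_bipartite_biclique[OF K] by metis
    obtain c where c: "X = {c}" using XY(2) by (auto simp: card_1_singleton_iff)
    obtain x y z where y: "Y = {x, y, z}" "x \<noteq> y" "x \<noteq> z" "y \<noteq> z"
      using XY(3) by (auto simp: card_3_iff)
    have ne: "c \<noteq> x" "c \<noteq> y" "c \<noteq> z" using XY(1) c y by auto
    have E: "E = {{c, x}, {c, y}, {c, z}}" using XY(5) c y by (auto simp: biclique_iff)
    \<comment> \<open>Moving the edge from \<open>{c, z}\<close> to \<open>{y, z}\<close> turns the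
      claw into the path x, c, y, z. Cutting it in the middle gives one edge on each side and one
      crossing edge, and 1 < 4.\<close>
    let ?F = "{{c, x}, {c, y}}" and ?H = "{{c, x}, {c, y}, {y, z}}"
    have "?F = E - {{c, z}}" using y ne by (auto simp: E doubleton_eq_iff)
    then have 1: "(E, ?F) \<in> edit_step V" by (auto simp: edit_step_def E)
    have "{y, z} \<in> nsets V 2 - ?F" using XY(4) c y ne by (auto simp: doubleton_eq_iff)
    moreover have "?H = insert {y, z} ?F" by auto
    ultimately have 2: "(?F, ?H) \<in> edit_step V" unfolding edit_step_def by blast
    have steps: "(E, ?H) \<in> edit_step V ^^ 2" using 1 2 by (auto simp: numeral_2_eq_2)
    have H: "simple_graph V ?H" using edit_steps_simple_graph[OF steps G] .
    have V: "V - {c, x} = {y, z}" "{c, x} \<subseteq> V" using XY(4) c y ne by auto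
    have "{e \<in> ?H. e \<subseteq> {c, x}} = {{c, x}}" "{e \<in> ?H. e \<subseteq> {y, z}} = {{y, z}}"
      "{e \<in> ?H. e \<inter> {c, x} \<noteq> {} \<and> \<not> e \<subseteq> {c, x}} = {{c, y}}"
      using y ne by auto
    then have "crossing ?H {c, x} ^ 2 < 4 * edges_within ?H {c, x} * edges_within ?H (V - {c, x})"
      unfolding V(1) edges_within_def crossing_def by simp
    then have "max_modularity V ?H > 0" using max_modularity_pos_iff[OF H] V(2) by blast
    with steps show "\<exists>E'. (E, E') \<in> edit_step V ^^ 2 \<and> max_modularity V E' > 0" by blast
  next
    fix k assume "\<exists>E'. (E, E') \<in> edit_step V ^^ k \<and> max_modularity V E' > 0"
    then obtain E' where E': "(E, E') \<in> edit_step V ^^ k" "max_modularity V E' > 0" by blast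
    have "\<not> E \<subseteq> E'"
      using claw_supergraph_not_pos[OF K] edit_steps_simple_graph[OF E'(1) G] E'(2) by blast
    moreover have "\<not> E' \<subseteq> E" using star_subgraph_not_pos[OF K] E'(2) by blast
    \<comment> \<open>After at most one edit the result is comparable with \<open>E\<close> under
      inclusion, and both directions have just been excluded.\<close>
    ultimately have "k \<noteq> 0" "k \<noteq> 1" using E'(1) by (auto simp: edit_step_def)
    then show "2 \<le> k" by simp
  qed
  then show ?thesis by (simp add: numeral_eq_enat)
qed

theorem theorem1p2:
  fixes V :: "'a set" and E :: "'a set set" and s t :: nat
  assumes "1 \<le> s" and "s \<le> t"
    and "complete_bipartite s t V E"
  shows "((s = 1 \<longrightarrow> delta_minus V E = \<infinity>) \<and>
          (s \<ge> 2 \<longrightarrow> delta_minus V E = 1)) \<and>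
         (((s = 1 \<and> t \<ge> 4) \<or> (s \<ge> 2 \<and> t \<ge> 3) \<longrightarrow> delta_plus V E = 1) \<and>
          (\<not> ((s = 1 \<and> t \<ge> 4) \<or> (s \<ge> 2 \<and> t \<ge> 3)) \<longleftrightarrow>
             (s, t) \<in> {(1, 1), (1, 2), (1, 3), (2, 2)}) \<and>
          ((s, t) \<in> {(1, 1), (1, 2), (1, 3), (2, 2)} \<longrightarrow> delta_plus V E = \<infinity>)) \<and>
         (((s = 1 \<and> t \<ge> 4) \<or> s \<ge> 2 \<longrightarrow> delta V E = 1) \<and>
          ((s, t) \<in> {(1, 1), (1, 2)} \<longrightarrow> delta V E = \<infinity>) \<and>
          ((s, t) = (1, 3) \<longrightarrow> delta V E = 2))"
proof -
  note K = assms(3)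
  note G = complete_bipartite_simple_graph[OF K] and np = complete_bipartite_not_pos[OF K]
  note cards = complete_bipartite_card[OF K]
  have minus_inf: "delta_minus V E = \<infinity>" if "s = 1"
    using star_subgraph_not_pos K that by (intro delta_minus_eq_infinity) blast
  \<comment> \<open>A deletion settles \<open>delta\<close> for every s \<ge> 2, including (2, 2),
    where additions do not help.\<close>
  have minus: "delta_minus V E = 1 \<and> delta V E = 1" if st: "2 \<le> s"
  proof -
    obtain e where e: "e \<in> E" "max_modularity V (E - {e}) > 0"
      using complete_bipartite_remove_pos[OF K st assms(2)] .
    then have "(E, E - {e}) \<in> edit_step V" by (auto simp: edit_step_def)
    then show ?thesis using delta_minus_eq_1[OF G np e] delta_eq_1[OF np _ e(2)] by blast
  qed
  have plus: "delta_plus V E = 1 \<and> delta V E = 1" if st: "s = 1 \<and> 4 \<le> t \<or> 2 \<le> s \<and> 3 \<le> t"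
  proof -
    obtain e where e: "e \<in> nsets V 2 - E" "max_modularity V (insert e E) > 0"
      using complete_bipartite_add_pos[OF K st assms(2)] .
    then have "(E, insert e E) \<in> edit_step V" unfolding edit_step_def by blast
    then show ?thesis using delta_plus_eq_1[OF G np e] delta_eq_1[OF np _ e(2)] by blast
  qed
  \<comment> \<open>These graphs have two or three vertices, whereas positivity on at most four
    vertices requires exactly four.\<close>
  have small: "\<not> max_modularity V F > 0" if "simple_graph V F" "(s, t) \<in> {(1, 1), (1, 2)}" for F
    using max_modularity_pos_card_edges(1)[OF that(1)] cards(1) that(2) by auto
  have plus_inf: "delta_plus V E = \<infinity>" if st: "(s, t) \<in> {(1, 1), (1, 2), (1, 3), (2, 2)}"
  proof (rule delta_plus_eq_infinity[OF G])
    fix F assume F: "simple_graph V F" "E \<subseteq> F"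
    have "card E \<le> card F" using F by (intro card_mono simple_graph_finite_edges)
    \<comment> \<open>The 4-cycle already exceeds the limit of three edges on four vertices.\<close>
    then have "\<not> max_modularity V F > 0" if "(s, t) = (2, 2)"
      using max_modularity_pos_card_edges(2)[OF F(1)] cards that by auto
    then show "\<not> max_modularity V F > 0"
      using st small[OF F(1)] claw_supergraph_not_pos[OF _ F] K by blast
  qed
  have dinf: "delta V E = \<infinity>" if "(s, t) \<in> {(1, 1), (1, 2)}"
    using delta_eq_infinity[OF G] small that by blast
  have claw: "delta V E = 2" if "(s, t) = (1, 3)"
    using delta_claw K that by blast
  have cases: "\<not> ((s = 1 \<and> t \<ge> 4) \<or> (s \<ge> 2 \<and> t \<ge> 3)) \<longleftrightarrow> (s, t) \<in> {(1, 1), (1, 2), (1, 3), (2, 2)}"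
    using assms(1,2) by auto
  show ?thesis
    using minus_inf minus plus plus_inf dinf claw cases by blast
qed

end
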